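(* Let $r\ge1$, let $\mathfrak{g}=\mathfrak{sl}_{r+1}$, and let $\lambda$ be a dominant integral weight of $\mathfrak{g}$ with corresponding integer tuple $\underline{\lambda}:\lambda_1\ge\cdots\ge\lambda_r\ge\lambda_{r+1}=0$. For every POP $\mathfrak{P}$ with bounding sequence $\underline{\lambda}$: (i) $v_{\mathfrak{P}}$ is a homogeneous vector of the local Weyl module $W(\lambda)$, with grade equal to the number of boxes in $\mathfrak{P}$; and (ii) the $\mathfrak{h}$-weight of $v_{\mathfrak{P}}$ is the weight of (the pattern underlying) $\mathfrak{P}$.
   Context: $\mathfrak{g}=\mathfrak{sl}_{r+1}$ is the Lie algebra of traceless complex $(r+1)\times(r+1)$ matrices; $\mathfrak{h}$ and $\mathfrak{n}^+$ are its diagonal and strictly upper triangular subalgebras. $\epsilon_i\in\mathfrak{h}^\star$ maps a diagonal matrix to its $(i,i)$ entry; the tuple $(a_1,\ldots,a_{r+1})$ is identified with the weight $\sum a_i\epsilon_i$. Dominant integral weights correspond to integer tuples $\lambda_1\ge\cdots\ge\lambda_r\ge\lambda_{r+1}=0$. $\mathfrak{g}[t]=\mathfrak{g}\otimes\mathbb{C}[t]$ has bracket $[X\otimes f,Y\otimes g]=[X,Y]\otimes fg$ and is graded by degree in $t$. The local Weyl module $W(\lambda)$ is the cyclic $\mathfrak{g}[t]$-module generated by an element $w_\lambda$ subject to: $(\mathfrak{n}^+\otimes\mathbb{C}[t])w_\lambda=0$; $(\mathfrak{h}\otimes t\mathbb{C}[t])w_\lambda=0$; $Hw_\lambda=\langle\lambda,H\rangle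 w_\lambda$ for $H\in\mathfrak{h}$; and $\mathfrak{g}_{-\alpha}^{\langle\lambda,\alpha^\vee\rangle+1}w_\lambda=0$ for every simple root $\alpha$ ($\alpha^\vee$ the coroot, $\mathfrak{g}_{-\alpha}$ the root space of $-\alpha$). It is graded, with $w_\lambda$ in grade $0$. A partition is a non-increasing, eventually zero sequence of non-negative integers; its non-zero terms are its parts; $|\pi|$ is the sum of the terms of $\pi$. It fits into the rectangle $(a,b)$ if it has at most $a$ parts and every part is at most $b$. Non-increasing sequences $\lambda$ of length $m$ and $\mu$ of length $m-1$ interlace if $\lambda_i\ge\mu_i\ge\lambda_{i+1}$ for $1\le i\le m-1$. An integral GT pattern is a sequence $\lambda^1,\ldots,\lambda^n$ of non-increasing integer sequences, $\lambda^j$ of length $j$, with $\lambda^j,\lambda^{j+1}$ interlacing for $1\le j\le n-1$; $\lambda^n$ is its bounding sequence; its weight is $(a_1,\ldots,a_n)$ where $a_j$ is the sum of row $j$ minus the sum of row $j-1$ (row $0$ is empty). A partition overlaid pattern (POP) $\mathfrak{P}$ consists of an integral GT pattern $\lambda^1,\ldots,\lambda^n$ and, for every pair $(j,i)$ with $1\le j<n$, $1\le i\le j$, a partition $\pi(j)^i$ that fits into the rectangle $(\lambda^{j+1}_i-\lambda^j_i,\ \lambda^j_i-\lambda^{j+1}_{i+1})$. Its bounding sequence and weight are those of the underlying pattern, and its number of boxes is $\sum_{(j,i)}|\pi(j)^i|$. For $1\le i\le j\le r$ let $x_{ij}^-$ be the $(r+1)\times(r+1)$ matrix whose only non-zero entry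 is a $1$ in position $(j+1,i)$. For a partition $\pi$ fitting into $(a,b)$, let $m_k$ be the number of parts of $\pi$ equal to $k$ for $1\le k\le b$, let $m_0=a-\sum_{k=1}^b m_k$, and put $x_{ij}^-(a,b,\pi)=\prod_{k=0}^b (x_{ij}^-\otimes t^k)^{(m_k)}\in U(\mathfrak{g}[t])$, where $T^{(m)}=T^m/m!$. For a POP $\mathfrak{P}$ with rows $\lambda^1,\ldots,\lambda^{r+1}=\underline{\lambda}$ and partitions $\pi(j)^i$, put $$\rho^j_{\mathfrak{P}}=\prod_{i=1}^j x_{ij}^-\left(\lambda_i^{j+1}-\lambda_i^j,\ \lambda_i^j-\lambda_{i+1}^{j+1},\ \pi(j)^i\right)\quad(1\le j\le r),$$ $\rho_{\mathfrak{P}}=\rho^1_{\mathfrak{P}}\rho^2_{\mathfrak{P}}\cdots\rho^r_{\mathfrak{P}}$ (in this order), and $v_{\mathfrak{P}}=\rho_{\mathfrak{P}}w_\lambda$. *)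

theory Defs
  imports
    "HOL-Library.Poly_Mapping"
    "HOL-Algebra.QuotRing"
    "HOL-Algebra.Module"
    "HOL-Computational_Algebra.Polynomial"
    "Jordan_Normal_Form.Matrix"
begin

section \<open>The Lie algebra \<open>sl\<close> and its current algebra\<close>

definition mat_trace :: "'a::comm_monoid_add mat \<Rightarrow> 'a" where
  "mat_trace A = (\<Sum>p<dim_row A. A $$ (p, p))"

definition lie_bracket :: "'a::ring_1 mat \<Rightarrow> 'a mat \<Rightarrow> 'a mat" where
  "lie_bracket X Y = X * Y - Y * X"

definition sl :: "nat \<Rightarrow> 'a::comm_ring_1 mat set" where
  "sl n = {X \<in> carrier_mat n n. mat_trace X = 0}"

definition cartan :: "nat \<Rightarrow> complex mat set" where
  "cartan r = {H \<in> sl (r + 1). diagonal_mat H}"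

definition n_plus :: "nat \<Rightarrow> complex mat set" where
  "n_plus r = {X \<in> sl (r + 1). \<forall>p<r + 1. \<forall>q\<le>p. X $$ (p, q) = 0}"

text \<open>The tensor product \<open>sl \<otimes> \<complex>[t]\<close> is realised as the traceless matrices over \<open>\<complex>[t]\<close> with
  the commutator bracket; the pure tensor \<open>X \<otimes> f\<close> is the matrix with entries \<open>X\<^sub>p\<^sub>q f\<close>.\<close>

definition current_algebra :: "nat \<Rightarrow> complex poly mat set" where
  "current_algebra r = sl (r + 1)"

definition tens :: "complex mat \<Rightarrow> complex poly \<Rightarrow> complex poly mat" where
  "tens X f = map_mat (\<lambda>c. Polynomial.smult c f) X"


section \<open>Weights\<close>

text \<open>Weights are functions on matrices of which only the restriction to \<^const>\<open>cartan\<close> matters.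
  The indices of matrix entries in Jordan-Normal-Form start at 0, all other indices below start
  at 1.\<close>

definition eps :: "nat \<Rightarrow> complex mat \<Rightarrow> complex" where
  "eps i H = H $$ (i - 1, i - 1)"

definition tuple_weight :: "nat \<Rightarrow> (nat \<Rightarrow> int) \<Rightarrow> complex mat \<Rightarrow> complex" where
  "tuple_weight r a H = (\<Sum>i = 1..r + 1. of_int (a i) * eps i H)"

definition simple_root :: "nat \<Rightarrow> complex mat \<Rightarrow> complex" where
  "simple_root i H = eps i H - eps (i + 1) H"

definition simple_coroot :: "nat \<Rightarrow> nat \<Rightarrow> complex mat" where
  "simple_coroot r i = mat (r + 1) (r + 1)
     (\<lambda>(p, q). if p = i - 1 \<and> q = i - 1 then 1 else if p = i \<and> q = i then - 1 else 0)"

definition root_space :: "nat \<Rightarrow> (complex mat \<Rightarrow> complex) \<Rightarrow> complex mat set" where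
  "root_space r \<beta> = {X \<in> sl (r + 1). \<forall>H\<in>cartan r. lie_bracket H X = \<beta> H \<cdot>\<^sub>m X}"

definition dominant_integral :: "nat \<Rightarrow> (complex mat \<Rightarrow> complex) \<Rightarrow> bool" where
  "dominant_integral r \<Lambda> \<longleftrightarrow>
     (\<forall>H\<in>cartan r. \<forall>H'\<in>cartan r. \<Lambda> (H + H') = \<Lambda> H + \<Lambda> H') \<and>
     (\<forall>c. \<forall>H\<in>cartan r. \<Lambda> (c \<cdot>\<^sub>m H) = c * \<Lambda> H) \<and>
     (\<forall>i\<in>{1..r}. \<Lambda> (simple_coroot r i) \<in> \<nat>)"

definition corresponding_tuple ::
    "nat \<Rightarrow> (complex mat \<Rightarrow> complex) \<Rightarrow> (nat \<Rightarrow> int) \<Rightarrow> bool" where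
  "corresponding_tuple r \<Lambda> lam \<longleftrightarrow>
     (\<forall>i\<in>{1..r}. lam i \<ge> lam (i + 1)) \<and> lam (r + 1) = 0 \<and>
     (\<forall>H\<in>cartan r. \<Lambda> H = tuple_weight r lam H)"


section \<open>The universal enveloping algebra of the current algebra\<close>

text \<open>The free complex algebra on a type is the monoid algebra of the free monoid, i.e.\ the
  finitely supported functions from words to complex numbers with convolution.\<close>

datatype 'a word = Word (letters: "'a list")

instantiation word :: (type) monoid_add
begin
definition zero_word :: "'a word" where "0 = Word []"
definition plus_word :: "'a word \<Rightarrow> 'a word \<Rightarrow> 'a word" where
  "v + w = Word (letters v @ letters w)"
instance by standard (auto simp: zero_word_def plus_word_def)
end

type_synonym 'a free_alg = "'a word \<Rightarrow>\<^sub>0 complex"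

definition free_algebra :: "'a set \<Rightarrow> 'a free_alg ring" where
  "free_algebra L =
     \<lparr>carrier = {f. \<forall>w\<in>Poly_Mapping.keys f. set (letters w) \<subseteq> L},
      monoid.mult = (*), one = 1, zero = 0, add = (+)\<rparr>"

definition fconst :: "complex \<Rightarrow> 'a free_alg" where
  "fconst c = Poly_Mapping.single 0 c"

definition fvar :: "'a \<Rightarrow> 'a free_alg" where
  "fvar x = Poly_Mapping.single (Word [x]) 1"

definition env_relations :: "nat \<Rightarrow> complex poly mat free_alg set" where
  "env_relations r =
     {fvar (x + y) - fvar x - fvar y | x y. x \<in> current_algebra r \<and> y \<in> current_algebra r} \<union>
     {fvar ([:c:] \<cdot>\<^sub>m x) - fconst c * fvar x | c x. x \<in> current_algebra r} \<union>
     {fvar x * fvar y - fvar y * fvar x - fvar (lie_bracket x y) | x y.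
        x \<in> current_algebra r \<and> y \<in> current_algebra r}"

definition env_ideal :: "nat \<Rightarrow> complex poly mat free_alg set" where
  "env_ideal r = genideal (free_algebra (current_algebra r)) (env_relations r)"

definition env :: "nat \<Rightarrow> complex poly mat free_alg set ring" where
  "env r = free_algebra (current_algebra r) Quot env_ideal r"

definition env_class ::
    "nat \<Rightarrow> complex poly mat free_alg \<Rightarrow> complex poly mat free_alg set" where
  "env_class r f = env_ideal r +>\<^bsub>free_algebra (current_algebra r)\<^esub> f"

definition env_const :: "nat \<Rightarrow> complex \<Rightarrow> complex poly mat free_alg set" where
  "env_const r c = env_class r (fconst c)"

definition env_of :: "nat \<Rightarrow> complex poly mat \<Rightarrow> complex poly mat free_alg set" where
  "env_of r x = env_class r (fvar x)"

text \<open>The degree \<open>d\<close> part is spanned by the products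
  \<open>(X\<^sub>1 \<otimes> t\<^sup>k\<^sup>1) \<cdots> (X\<^sub>m \<otimes> t\<^sup>k\<^sup>m)\<close> with \<open>k\<^sub>1 + \<cdots> + k\<^sub>m = d\<close>.\<close>

definition word_has_degree :: "nat \<Rightarrow> complex poly mat word \<Rightarrow> nat \<Rightarrow> bool" where
  "word_has_degree r w d \<longleftrightarrow>
     (\<exists>Xs. (\<forall>(X, k)\<in>set Xs. X \<in> sl (r + 1)) \<and>
           letters w = map (\<lambda>(X, k). tens X (monom 1 k)) Xs \<and>
           d = sum_list (map snd Xs))"

definition env_grade :: "nat \<Rightarrow> nat \<Rightarrow> complex poly mat free_alg set set" where
  "env_grade r d = {env_class r f | f. \<forall>w\<in>Poly_Mapping.keys f. word_has_degree r w d}"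


section \<open>Local Weyl modules\<close>

definition left_ideal :: "'a set \<Rightarrow> 'a ring \<Rightarrow> bool" where
  "left_ideal J R \<longleftrightarrow> additive_subgroup J R \<and> (\<forall>a\<in>carrier R. \<forall>x\<in>J. a \<otimes>\<^bsub>R\<^esub> x \<in> J)"

definition gen_left_ideal :: "'a ring \<Rightarrow> 'a set \<Rightarrow> 'a set" where
  "gen_left_ideal R S = \<Inter>{J. left_ideal J R \<and> S \<subseteq> J}"

text \<open>The left module \<open>R / J\<close>. The record type \<^typ>\<open>('a, 'b) module\<close> extends that of rings; its
  fields \<open>mult\<close> and \<open>one\<close> play no role here. As for \<^const>\<open>rcoset_mult\<close>, the action on a coset is
  written without choosing a representative.\<close>

definition quot_module :: "'a ring \<Rightarrow> 'a set \<Rightarrow> ('a, 'a set) module" where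
  "quot_module R J =
     \<lparr>carrier = a_rcosets\<^bsub>R\<^esub> J, monoid.mult = undefined, one = undefined,
      zero = J, add = set_add R,
      smult = (\<lambda>a A. \<Union>b\<in>A. J +>\<^bsub>R\<^esub> (a \<otimes>\<^bsub>R\<^esub> b))\<rparr>"

definition weyl_relations ::
    "nat \<Rightarrow> (complex mat \<Rightarrow> complex) \<Rightarrow> complex poly mat free_alg set set" where
  "weyl_relations r \<Lambda> =
     {env_of r (tens X f) | X f. X \<in> n_plus r} \<union>
     {env_of r (tens H (monom 1 1 * f)) | H f. H \<in> cartan r} \<union>
     {env_of r (tens H 1) \<ominus>\<^bsub>env r\<^esub> env_const r (\<Lambda> H) | H. H \<in> cartan r} \<union>
     {env_of r (tens Y 1) [^]\<^bsub>env r\<^esub> (m + 1) | Y i m.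
        i \<in> {1..r} \<and> Y \<in> root_space r (\<lambda>H. - simple_root i H) \<and>
        \<Lambda> (simple_coroot r i) = of_nat m}"

definition weyl_ideal ::
    "nat \<Rightarrow> (complex mat \<Rightarrow> complex) \<Rightarrow> complex poly mat free_alg set set" where
  "weyl_ideal r \<Lambda> = gen_left_ideal (env r) (weyl_relations r \<Lambda>)"

definition local_weyl ::
    "nat \<Rightarrow> (complex mat \<Rightarrow> complex) \<Rightarrow>
     (complex poly mat free_alg set, complex poly mat free_alg set set) module" where
  "local_weyl r \<Lambda> = quot_module (env r) (weyl_ideal r \<Lambda>)"

definition weyl_gen ::
    "nat \<Rightarrow> (complex mat \<Rightarrow> complex) \<Rightarrow> complex poly mat free_alg set set" where
  "weyl_gen r \<Lambda> = weyl_ideal r \<Lambda> +>\<^bsub>env r\<^esub> \<one>\<^bsub>env r\<^esub>"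

text \<open>The grading induced from that of the enveloping algebra, with the generator in grade 0.\<close>

definition weyl_grade ::
    "nat \<Rightarrow> (complex mat \<Rightarrow> complex) \<Rightarrow> nat \<Rightarrow> complex poly mat free_alg set set set" where
  "weyl_grade r \<Lambda> d = {u \<odot>\<^bsub>local_weyl r \<Lambda>\<^esub> weyl_gen r \<Lambda> | u. u \<in> env_grade r d}"

definition weyl_weight_space ::
    "nat \<Rightarrow> (complex mat \<Rightarrow> complex) \<Rightarrow> (complex mat \<Rightarrow> complex) \<Rightarrow>
     complex poly mat free_alg set set set" where
  "weyl_weight_space r \<Lambda> \<mu> =
     {v \<in> carrier (local_weyl r \<Lambda>). \<forall>H\<in>cartan r.
        env_of r (tens H 1) \<odot>\<^bsub>local_weyl r \<Lambda>\<^esub> v = env_const r (\<mu> H) \<odot>\<^bsub>local_weyl r \<Lambda>\<^esub> v}"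


section \<open>Partition overlaid patterns\<close>

text \<open>A partition is a sequence whose terms are indexed from 0.\<close>

definition is_partition :: "(nat \<Rightarrow> nat) \<Rightarrow> bool" where
  "is_partition \<pi> \<longleftrightarrow> antimono \<pi> \<and> (\<exists>N. \<forall>n\<ge>N. \<pi> n = 0)"

definition partition_size :: "(nat \<Rightarrow> nat) \<Rightarrow> nat" where
  "partition_size \<pi> = (\<Sum>n\<in>{n. \<pi> n \<noteq> 0}. \<pi> n)"

definition fits :: "(nat \<Rightarrow> nat) \<Rightarrow> int \<Rightarrow> int \<Rightarrow> bool" where
  "fits \<pi> a b \<longleftrightarrow> int (card {n. \<pi> n \<noteq> 0}) \<le> a \<and> (\<forall>n. \<pi> n \<noteq> 0 \<longrightarrow> int (\<pi> n) \<le> b)"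

text \<open>Row \<open>j\<close> of a pattern consists of the values \<open>p j 1, \<dots>, p j j\<close>; all other values of \<open>p\<close> are
  irrelevant, and likewise for the overlay of a POP.\<close>

definition is_GT_pattern :: "nat \<Rightarrow> (nat \<Rightarrow> nat \<Rightarrow> int) \<Rightarrow> bool" where
  "is_GT_pattern n p \<longleftrightarrow>
     (\<forall>j\<in>{1..n}. \<forall>i\<in>{1..<j}. p j i \<ge> p j (i + 1)) \<and>
     (\<forall>j\<in>{1..<n}. \<forall>i\<in>{1..j}. p (j + 1) i \<ge> p j i \<and> p j i \<ge> p (j + 1) (i + 1))"

definition GT_weight :: "(nat \<Rightarrow> nat \<Rightarrow> int) \<Rightarrow> nat \<Rightarrow> int" where
  "GT_weight p j = (\<Sum>i = 1..j. p j i) - (\<Sum>i = 1..j - 1. p (j - 1) i)"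

record pop =
  pattern :: "nat \<Rightarrow> nat \<Rightarrow> int"
  overlay :: "nat \<Rightarrow> nat \<Rightarrow> nat \<Rightarrow> nat"

definition is_POP :: "nat \<Rightarrow> pop \<Rightarrow> bool" where
  "is_POP n P \<longleftrightarrow> is_GT_pattern n (pattern P) \<and>
     (\<forall>j\<in>{1..<n}. \<forall>i\<in>{1..j}. is_partition (overlay P j i) \<and>
        fits (overlay P j i) (pattern P (j + 1) i - pattern P j i)
                             (pattern P j i - pattern P (j + 1) (i + 1)))"

definition has_bounding_sequence :: "nat \<Rightarrow> pop \<Rightarrow> (nat \<Rightarrow> int) \<Rightarrow> bool" where
  "has_bounding_sequence n P lam \<longleftrightarrow> (\<forall>i\<in>{1..n}. pattern P n i = lam i)"

definition num_boxes :: "nat \<Rightarrow> pop \<Rightarrow> nat" where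
  "num_boxes n P = (\<Sum>j = 1..<n. \<Sum>i = 1..j. partition_size (overlay P j i))"


section \<open>The vector attached to a POP\<close>

definition x_minus :: "nat \<Rightarrow> nat \<Rightarrow> nat \<Rightarrow> complex mat" where
  "x_minus r i j = mat (r + 1) (r + 1) (\<lambda>(p, q). if p = j \<and> q = i - 1 then 1 else 0)"

definition ordered_prod :: "('a, 'b) monoid_scheme \<Rightarrow> 'a list \<Rightarrow> 'a" where
  "ordered_prod R xs = foldr (\<lambda>x y. x \<otimes>\<^bsub>R\<^esub> y) xs \<one>\<^bsub>R\<^esub>"

definition divided_power ::
    "nat \<Rightarrow> complex poly mat free_alg set \<Rightarrow> nat \<Rightarrow> complex poly mat free_alg set" where
  "divided_power r T m = env_const r (1 / fact m) \<otimes>\<^bsub>env r\<^esub> (T [^]\<^bsub>env r\<^esub> m)"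

definition part_mult :: "nat \<Rightarrow> nat \<Rightarrow> (nat \<Rightarrow> nat) \<Rightarrow> nat \<Rightarrow> nat" where
  "part_mult a b \<pi> k =
     (if k = 0 then a - (\<Sum>l = 1..b. card {n. \<pi> n = l}) else card {n. \<pi> n = k})"

definition x_elem ::
    "nat \<Rightarrow> nat \<Rightarrow> nat \<Rightarrow> nat \<Rightarrow> nat \<Rightarrow> (nat \<Rightarrow> nat) \<Rightarrow> complex poly mat free_alg set" where
  "x_elem r i j a b \<pi> = ordered_prod (env r)
     (map (\<lambda>k. divided_power r (env_of r (tens (x_minus r i j) (monom 1 k))) (part_mult a b \<pi> k))
       [0..<b + 1])"

text \<open>For a POP both arguments of \<^const>\<open>nat\<close> are non-negative.\<close>

definition rho_row :: "nat \<Rightarrow> pop \<Rightarrow> nat \<Rightarrow> complex poly mat free_alg set" where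
  "rho_row r P j = ordered_prod (env r)
     (map (\<lambda>i. x_elem r i j (nat (pattern P (j + 1) i - pattern P j i))
                            (nat (pattern P j i - pattern P (j + 1) (i + 1)))
                            (overlay P j i))
       [1..<j + 1])"

definition rho :: "nat \<Rightarrow> pop \<Rightarrow> complex poly mat free_alg set" where
  "rho r P = ordered_prod (env r) (map (rho_row r P) [1..<r + 1])"

definition v_vec :: "nat \<Rightarrow> (complex mat \<Rightarrow> complex) \<Rightarrow> pop \<Rightarrow> complex poly mat free_alg set set"
  where "v_vec r \<Lambda> P = rho r P \<odot>\<^bsub>local_weyl r \<Lambda>\<^esub> weyl_gen r \<Lambda>"

end

theory Submission
  imports Defs
begin

text \<open>The grade is clear, since \<open>\<Sum>\<^sub>k k m\<^sub>k = |\<pi>|\<close> for the multiplicities \<open>m\<^sub>k\<close> of the parts of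
  \<open>\<pi>\<close>. For the weight, \<open>x\<^sub>i\<^sub>j\<^sup>- \<otimes> t\<^sup>k\<close> has weight \<open>\<epsilon>\<^sub>j\<^sub>+\<^sub>1 - \<epsilon>\<^sub>i\<close> under the adjoint action of the Cartan
  subalgebra whatever \<open>k\<close> is, and there are \<open>\<Sum>\<^sub>k m\<^sub>k = \<lambda>\<^sub>i\<^sup>j\<^sup>+\<^sup>1 - \<lambda>\<^sub>i\<^sup>j\<close> such factors for each \<open>(j, i)\<close>.
  Adding the terms \<open>(\<lambda>\<^sub>i\<^sup>j\<^sup>+\<^sup>1 - \<lambda>\<^sub>i\<^sup>j)(\<epsilon>\<^sub>j\<^sub>+\<^sub>1 - \<epsilon>\<^sub>i)\<close> to row \<open>j + 1\<close>, read as a weight, turns it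
  into row \<open>j\<close> plus the \<open>(j + 1)\<close>-st coordinate of the pattern's weight; starting from the weight
  of the generator, which is row \<open>r + 1\<close>, the sum telescopes.\<close>

section \<open>The free algebra and the enveloping algebra\<close>

lemma ring_free_algebra: "ring (free_algebra L)"
proof (rule ringI)
  have add: "f + g \<in> carrier (free_algebra L)"
    if "f \<in> carrier (free_algebra L)" "g \<in> carrier (free_algebra L)" for f g
    using that Poly_Mapping.keys_add[of f g] by (auto simp: free_algebra_def)
  show "abelian_group (free_algebra L)"
  proof (rule abelian_groupI)
    fix f assume "f \<in> carrier (free_algebra L)"
    then show "\<exists>g\<in>carrier (free_algebra L). g \<oplus>\<^bsub>free_algebra L\<^esub> f = \<zero>\<^bsub>free_algebra L\<^esub>"
      by (intro bexI[of _ "- f"]) (auto simp: free_algebra_def)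
  next
    show "f \<oplus>\<^bsub>free_algebra L\<^esub> g \<in> carrier (free_algebra L)"
      if "f \<in> carrier (free_algebra L)" "g \<in> carrier (free_algebra L)" for f g
      using add[OF that] by (simp add: free_algebra_def)
  qed (simp_all add: free_algebra_def add_ac)
  have mult: "f * g \<in> carrier (free_algebra L)"
    if fg: "f \<in> carrier (free_algebra L)" "g \<in> carrier (free_algebra L)" for f g
  proof -
    have "set (letters w) \<subseteq> L" if w: "w \<in> Poly_Mapping.keys (f * g)" for w
    proof -
      obtain u v where "w = u + v" "u \<in> Poly_Mapping.keys f" "v \<in> Poly_Mapping.keys g"
        using w keys_mult[of f g] by blast
      then show ?thesis
        using fg by (simp add: free_algebra_def plus_word_def)
    qed
    then show ?thesis
      by (simp add: free_algebra_def)
  qed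
  \<comment> \<open>The unit is kept as a \<open>single\<close>, so that its only key is visibly the
    empty word.\<close>
  have one: "Poly_Mapping.single 0 1 \<in> carrier (free_algebra L)"
    by (simp add: free_algebra_def zero_word_def del: single_one)
  show "Group.monoid (free_algebra L)"
  proof (rule Group.monoidI)
    show "f \<otimes>\<^bsub>free_algebra L\<^esub> g \<in> carrier (free_algebra L)"
      if "f \<in> carrier (free_algebra L)" "g \<in> carrier (free_algebra L)" for f g
      using mult[OF that] by (simp add: free_algebra_def)
    show "\<one>\<^bsub>free_algebra L\<^esub> \<in> carrier (free_algebra L)"
      using one by (simp add: free_algebra_def)
  qed (simp_all add: free_algebra_def mult.assoc)
qed (simp_all add: free_algebra_def distrib_left distrib_right)

lemma fconst_in_free_algebra: "fconst c \<in> carrier (free_algebra L)"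
  by (auto simp: free_algebra_def fconst_def zero_word_def)

lemma fvar_in_free_algebra: "x \<in> L \<Longrightarrow> fvar x \<in> carrier (free_algebra L)"
  by (auto simp: free_algebra_def fvar_def)

lemma minus_in_free_algebra:
  "f \<in> carrier (free_algebra L) \<Longrightarrow> g \<in> carrier (free_algebra L) \<Longrightarrow>
    f - g \<in> carrier (free_algebra L)"
  using Poly_Mapping.keys_diff[of f g] by (auto simp: free_algebra_def)

lemma plus_in_free_algebra:
  "f \<in> carrier (free_algebra L) \<Longrightarrow> g \<in> carrier (free_algebra L) \<Longrightarrow>
    f + g \<in> carrier (free_algebra L)"
  using Poly_Mapping.keys_add[of f g] by (auto simp: free_algebra_def)

lemma times_in_free_algebra:
  "f \<in> carrier (free_algebra L) \<Longrightarrow> g \<in> carrier (free_algebra L) \<Longrightarrow>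
    f * g \<in> carrier (free_algebra L)"
  using ring.ring_simprules(5)[OF ring_free_algebra[of L], of f g] by (simp add: free_algebra_def)

text \<open>Scalars are central because the empty word is neutral for concatenation and complex
  numbers commute; this makes \<open>env_const r c\<close> central in \<open>env r\<close>.\<close>

lemma fconst_commute: "fconst c * f = f * fconst c"
proof (induction f rule: update_induct)
  case (update f w a)
  \<comment> \<open>The key \<open>w\<close> is fresh, so the update is the addition of one monomial
    and distributivity reduces the claim to that monomial.\<close>
  have "Poly_Mapping.update w a f = f + Poly_Mapping.single w a"
    using update.hyps by (intro poly_mapping_eqI)
      (auto simp: lookup_update lookup_add lookup_single in_keys_iff when_def)
  moreover have "fconst c * Poly_Mapping.single w a = Poly_Mapping.single w a * fconst c"
    by (simp add: fconst_def mult_single mult.commute)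
  ultimately show ?case
    using update.IH by (simp add: distrib_left distrib_right)
qed simp

section \<open>Closure properties of traceless matrices, over complex numbers and polynomials
  alike\<close>

lemma sl_smult: "x \<in> sl n \<Longrightarrow> a \<cdot>\<^sub>m x \<in> sl n"
  by (auto simp: sl_def mat_trace_def simp flip: sum_distrib_left)

lemma sl_add: "x \<in> sl n \<Longrightarrow> y \<in> sl n \<Longrightarrow> x + y \<in> sl n"
  by (auto simp: sl_def mat_trace_def sum.distrib)

lemma lie_bracket_in_sl:
  assumes "x \<in> carrier_mat n n" "y \<in> carrier_mat n n"
  shows "lie_bracket x y \<in> sl n"
proof -
  \<comment> \<open>The traces of \<open>x * y\<close> and \<open>y * x\<close> agree after
    exchanging the two summations.\<close>
  have "(\<Sum>p<n. \<Sum>k = 0..<n. x $$ (p, k) * y $$ (k, p))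
      = (\<Sum>p<n. \<Sum>k = 0..<n. y $$ (p, k) * x $$ (k, p))"
    unfolding atLeast0LessThan by (subst sum.swap) (simp add: mult.commute)
  then show ?thesis
    using assms by (auto simp: sl_def lie_bracket_def mat_trace_def scalar_prod_def sum_subtractf)
qed

section \<open>The enveloping algebra as a quotient ring\<close>

lemma env_relations_subset: "env_relations r \<subseteq> carrier (free_algebra (current_algebra r))"
  by (auto simp: env_relations_def current_algebra_def sl_smult sl_add
      intro!: minus_in_free_algebra times_in_free_algebra fvar_in_free_algebra
        fconst_in_free_algebra lie_bracket_in_sl)
     (auto simp: sl_def)

lemma env_ideal: "ideal (env_ideal r) (free_algebra (current_algebra r))"
  unfolding env_ideal_def
  by (rule ring.genideal_ideal[OF ring_free_algebra env_relations_subset])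

lemma ring_env: "ring (env r)"
  unfolding env_def by (rule ideal.quotient_is_ring[OF env_ideal])

lemma env_class_hom: "env_class r \<in> Ring.ring_hom (free_algebra (current_algebra r)) (env r)"
  using ideal.rcos_ring_hom[OF env_ideal] by (simp add: env_def env_class_def[abs_def])

lemma env_class_closed:
  "f \<in> carrier (free_algebra (current_algebra r)) \<Longrightarrow> env_class r f \<in> carrier (env r)"
  using ring_hom_closed[OF env_class_hom] .

lemma env_class_surj:
  assumes "u \<in> carrier (env r)"
  obtains f where "f \<in> carrier (free_algebra (current_algebra r))" "u = env_class r f"
  using assms by (auto simp: env_def env_class_def FactRing_def A_RCOSETS_def')

lemma env_class_add:
  assumes "f \<in> carrier (free_algebra (current_algebra r))"
    and "g \<in> carrier (free_algebra (current_algebra r))"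
  shows "env_class r (f + g) = env_class r f \<oplus>\<^bsub>env r\<^esub> env_class r g"
  using ring_hom_add[OF env_class_hom assms] by (simp add: free_algebra_def)

lemma env_class_mult:
  assumes "f \<in> carrier (free_algebra (current_algebra r))"
    and "g \<in> carrier (free_algebra (current_algebra r))"
  shows "env_class r (f * g) = env_class r f \<otimes>\<^bsub>env r\<^esub> env_class r g"
  using ring_hom_mult[OF env_class_hom assms] by (simp add: free_algebra_def)

lemma env_class_one: "env_class r 1 = \<one>\<^bsub>env r\<^esub>"
  using ring_hom_one[OF env_class_hom] by (simp add: free_algebra_def)

text \<open>Each defining relation has the form \<open>f - g\<close>; this turns it into an equation
  in the quotient. Membership of \<open>f\<close> in the free algebra follows from
  \<open>f = (f - g) + g\<close>.\<close>

lemma env_class_eqI: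
  assumes "f - g \<in> env_relations r" "g \<in> carrier (free_algebra (current_algebra r))"
  shows "env_class r f = env_class r g"
proof -
  interpret ring "env r" by (rule ring_env)
  have fg: "f - g \<in> carrier (free_algebra (current_algebra r))"
    using assms(1) env_relations_subset by blast
  have "f - g \<in> env_ideal r"
    unfolding env_ideal_def
    using ring.genideal_self[OF ring_free_algebra env_relations_subset] assms(1) by blast
  then have "env_class r (f - g) = \<zero>\<^bsub>env r\<^esub>"
    using ring.a_rcos_zero[OF ring_free_algebra env_ideal]
    by (simp add: env_class_def env_def FactRing_def)
  then show ?thesis
    using env_class_add[OF fg assms(2)] env_class_closed[OF assms(2)] by simp
qed

lemma env_const_closed [simp]: "env_const r c \<in> carrier (env r)"
  by (simp add: env_const_def env_class_closed fconst_in_free_algebra)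

lemma env_of_closed: "x \<in> current_algebra r \<Longrightarrow> env_of r x \<in> carrier (env r)"
  by (simp add: env_of_def env_class_closed fvar_in_free_algebra)

lemma env_const_add: "env_const r (c + d) = env_const r c \<oplus>\<^bsub>env r\<^esub> env_const r d"
  by (simp add: env_const_def fconst_in_free_algebra flip: env_class_add)
     (simp add: fconst_def single_add)

lemma env_const_0: "env_const r 0 = \<zero>\<^bsub>env r\<^esub>"
  using ring_hom_zero[OF env_class_hom ring_free_algebra ring_env]
  by (simp add: env_const_def fconst_def free_algebra_def)

lemma env_const_commute:
  assumes "u \<in> carrier (env r)"
  shows "env_const r c \<otimes>\<^bsub>env r\<^esub> u = u \<otimes>\<^bsub>env r\<^esub> env_const r c"
  using assms
  by (elim env_class_surj)
     (simp add: env_const_def fconst_in_free_algebra fconst_commute flip: env_class_mult)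

lemma env_of_smult:
  assumes "x \<in> current_algebra r"
  shows "env_of r ([:c:] \<cdot>\<^sub>m x) = env_const r c \<otimes>\<^bsub>env r\<^esub> env_of r x"
proof -
  have "fvar ([:c:] \<cdot>\<^sub>m x) - fconst c * fvar x \<in> env_relations r"
    using assms unfolding env_relations_def by blast
  from env_class_eqI[OF this] show ?thesis
    using assms by (simp add: env_of_def env_const_def env_class_mult times_in_free_algebra
        fvar_in_free_algebra fconst_in_free_algebra)
qed

lemma env_of_commutator:
  assumes "x \<in> current_algebra r" "y \<in> current_algebra r"
  shows "env_of r x \<otimes>\<^bsub>env r\<^esub> env_of r y
    = env_of r y \<otimes>\<^bsub>env r\<^esub> env_of r x \<oplus>\<^bsub>env r\<^esub> env_of r (lie_bracket x y)"
proof -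
  let ?F = "carrier (free_algebra (current_algebra r))"
  have "lie_bracket x y \<in> current_algebra r"
    using assms lie_bracket_in_sl[of x "r + 1" y] by (simp add: current_algebra_def sl_def)
  then have *: "fvar x \<in> ?F" "fvar y \<in> ?F" "fvar (lie_bracket x y) \<in> ?F"
    using assms by (auto intro: fvar_in_free_algebra)
  have sum: "fvar y * fvar x + fvar (lie_bracket x y) \<in> ?F"
    by (intro plus_in_free_algebra times_in_free_algebra *)
  \<comment> \<open>Unfolding \<open>diff_diff_eq\<close> backwards gives the left-nested
    differences in which the commutator relations are written.\<close>
  have "fvar x * fvar y - (fvar y * fvar x + fvar (lie_bracket x y)) \<in> env_relations r"
    using assms unfolding env_relations_def diff_diff_eq[symmetric] by blast
  from env_class_eqI[OF this sum] show ?thesis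
    using * by (simp add: env_of_def env_class_mult env_class_add times_in_free_algebra)
qed


section \<open>Degrees and weights in the enveloping algebra\<close>

lemma sum_smult_right: "(\<Sum>x\<in>A. Polynomial.smult (c x) f) = Polynomial.smult (\<Sum>x\<in>A. c x) f"
  by (induction A rule: infinite_finite_induct) (simp_all add: smult_add_left)

lemma tens_in_current_algebra: "X \<in> sl (r + 1) \<Longrightarrow> tens X f \<in> current_algebra r"
  by (auto simp: current_algebra_def sl_def tens_def mat_trace_def sum_smult_right)

lemma word_has_degree_letters: "word_has_degree r w d \<Longrightarrow> set (letters w) \<subseteq> current_algebra r"
  by (fastforce simp: word_has_degree_def intro: tens_in_current_algebra[simplified])

lemma word_has_degree_0: "word_has_degree r 0 0"
  unfolding word_has_degree_def by (rule exI[of _ "[]"]) (simp add: zero_word_def)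

lemma word_has_degree_plus:
  assumes "word_has_degree r v d" "word_has_degree r w e"
  shows "word_has_degree r (v + w) (d + e)"
proof -
  obtain Xs Ys where "\<forall>(X, k)\<in>set Xs. X \<in> sl (r + 1)" "\<forall>(X, k)\<in>set Ys. X \<in> sl (r + 1)"
    "letters v = map (\<lambda>(X, k). tens X (monom 1 k)) Xs" "d = sum_list (map snd Xs)"
    "letters w = map (\<lambda>(X, k). tens X (monom 1 k)) Ys" "e = sum_list (map snd Ys)"
    using assms unfolding word_has_degree_def by blast
  then show ?thesis
    unfolding word_has_degree_def by (intro exI[of _ "Xs @ Ys"]) (auto simp: plus_word_def)
qed

text \<open>A word with a degree consists of pure tensors of traceless matrices, so homogeneity
  already carries the side condition for computing with classes.\<close>

lemma homogeneous_in_free_algebra: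
  "\<forall>w\<in>Poly_Mapping.keys f. word_has_degree r w d \<Longrightarrow>
    f \<in> carrier (free_algebra (current_algebra r))"
  using word_has_degree_letters by (fastforce simp: free_algebra_def)

lemma env_grade_subset: "env_grade r d \<subseteq> carrier (env r)"
  by (auto simp: env_grade_def intro!: env_class_closed homogeneous_in_free_algebra)

lemma env_const_in_env_grade: "env_const r c \<in> env_grade r 0"
  using word_has_degree_0 by (auto simp: env_grade_def env_const_def fconst_def intro!: exI split: if_splits)

lemma env_of_in_env_grade:
  assumes "X \<in> sl (r + 1)"
  shows "env_of r (tens X (monom 1 k)) \<in> env_grade r k"
proof -
  have "word_has_degree r (Word [tens X (monom 1 k)]) k"
    unfolding word_has_degree_def using assms by (intro exI[of _ "[(X, k)]"]) auto
  then have "\<forall>w\<in>Poly_Mapping.keys (fvar (tens X (monom 1 k))). word_has_degree r w k"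
    by (simp add: fvar_def)
  then show ?thesis
    unfolding env_grade_def env_of_def by blast
qed

text \<open>Homogeneous representatives suffice: every key of their product is a concatenation of
  keys, and degrees of words add under concatenation.\<close>

lemma env_grade_mult:
  assumes "u \<in> env_grade r d" "v \<in> env_grade r e"
  shows "u \<otimes>\<^bsub>env r\<^esub> v \<in> env_grade r (d + e)"
proof -
  obtain f g where f: "u = env_class r f" "\<forall>w\<in>Poly_Mapping.keys f. word_has_degree r w d"
    and g: "v = env_class r g" "\<forall>w\<in>Poly_Mapping.keys g. word_has_degree r w e"
    using assms by (auto simp: env_grade_def)
  have "\<forall>w\<in>Poly_Mapping.keys (f * g). word_has_degree r w (d + e)"
    using keys_mult[of f g] f(2) g(2) word_has_degree_plus by blast
  moreover have "u \<otimes>\<^bsub>env r\<^esub> v = env_class r (f * g)"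
    using f g by (simp add: env_class_mult homogeneous_in_free_algebra)
  ultimately show ?thesis
    unfolding env_grade_def by blast
qed

lemma env_const_1: "env_const r 1 = \<one>\<^bsub>env r\<^esub>"
  by (simp add: env_const_def fconst_def env_class_one)

section \<open>Weights under the adjoint action of the Cartan subalgebra\<close>

lemma lie_bracket_diagonal:
  fixes D :: "'b::comm_ring_1 mat"
  assumes "D \<in> carrier_mat n n" "diagonal_mat D" "X \<in> carrier_mat n n" "p < n" "q < n"
  shows "lie_bracket D X $$ (p, q) = (D $$ (p, p) - D $$ (q, q)) * X $$ (p, q)"
proof -
  \<comment> \<open>Since \<open>D\<close> is diagonal, only one index survives in each matrix
    product: \<open>p\<close> here, \<open>q\<close> in the next sum.\<close>
  have "(\<Sum>k = 0..<n. D $$ (p, k) * X $$ (k, q)) = D $$ (p, p) * X $$ (p, q)"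
    using assms by (subst sum.remove[of _ p]) (auto simp: diagonal_mat_def intro!: sum.neutral)
  moreover have "(\<Sum>k = 0..<n. X $$ (p, k) * D $$ (k, q)) = D $$ (q, q) * X $$ (p, q)"
    using assms by (subst sum.remove[of _ q]) (auto simp: diagonal_mat_def intro!: sum.neutral)
  ultimately show ?thesis
    using assms by (auto simp: lie_bracket_def scalar_prod_def left_diff_distrib)
qed

lemma x_minus_in_sl: "1 \<le> i \<Longrightarrow> i \<le> j \<Longrightarrow> j \<le> r \<Longrightarrow> x_minus r i j \<in> sl (r + 1)"
  by (auto simp: sl_def x_minus_def mat_trace_def intro!: sum.neutral)

text \<open>The equation says that \<open>u\<close> is an eigenvector of eigenvalue \<open>c\<close>
  for the commutator with \<open>H\<close>. Degree and eigenvalue are bundled because both are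
  additive under products, so each induction handles both at once.\<close>

definition env_bigraded ::
    "nat \<Rightarrow> complex mat \<Rightarrow> nat \<Rightarrow> complex \<Rightarrow> complex poly mat free_alg set \<Rightarrow> bool" where
  "env_bigraded r H d c u \<longleftrightarrow> u \<in> env_grade r d \<and>
     env_of r (tens H 1) \<otimes>\<^bsub>env r\<^esub> u
       = u \<otimes>\<^bsub>env r\<^esub> env_of r (tens H 1) \<oplus>\<^bsub>env r\<^esub> env_const r c \<otimes>\<^bsub>env r\<^esub> u"

context
  fixes r :: nat and H :: "complex mat"
  assumes H: "H \<in> cartan r"
begin

lemma env_of_cartan_closed: "env_of r (tens H 1) \<in> carrier (env r)"
  using H by (auto simp: cartan_def intro!: env_of_closed tens_in_current_algebra)

lemma env_bigraded_const: "env_bigraded r H 0 0 (env_const r c)"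
proof -
  interpret ring "env r" by (rule ring_env)
  show ?thesis
    using env_const_commute[OF env_of_cartan_closed, of c] env_of_cartan_closed
    by (simp add: env_bigraded_def env_const_in_env_grade env_const_0)
qed

text \<open>This is the Leibniz rule: \<open>H\<close> is moved past \<open>u\<close> and then past
  \<open>v\<close>, each time leaving a scalar multiple of the product.\<close>

lemma env_bigraded_mult:
  assumes "env_bigraded r H d b u" "env_bigraded r H e c v"
  shows "env_bigraded r H (d + e) (b + c) (u \<otimes>\<^bsub>env r\<^esub> v)"
proof -
  interpret ring "env r" by (rule ring_env)
  let ?h = "env_of r (tens H 1)"
  have closed: "u \<in> carrier (env r)" "v \<in> carrier (env r)" "?h \<in> carrier (env r)"
    using assms env_grade_subset env_of_cartan_closed by (auto simp: env_bigraded_def)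
  have "?h \<otimes>\<^bsub>env r\<^esub> (u \<otimes>\<^bsub>env r\<^esub> v)
      = (u \<otimes>\<^bsub>env r\<^esub> ?h \<oplus>\<^bsub>env r\<^esub> env_const r b \<otimes>\<^bsub>env r\<^esub> u) \<otimes>\<^bsub>env r\<^esub> v"
    using assms(1) closed by (simp add: env_bigraded_def flip: m_assoc)
  also have "\<dots> = u \<otimes>\<^bsub>env r\<^esub> (?h \<otimes>\<^bsub>env r\<^esub> v) \<oplus>\<^bsub>env r\<^esub> env_const r b \<otimes>\<^bsub>env r\<^esub> (u \<otimes>\<^bsub>env r\<^esub> v)"
    using closed by (simp add: l_distr m_assoc)
  also have "u \<otimes>\<^bsub>env r\<^esub> (?h \<otimes>\<^bsub>env r\<^esub> v)
      = (u \<otimes>\<^bsub>env r\<^esub> v) \<otimes>\<^bsub>env r\<^esub> ?h \<oplus>\<^bsub>env r\<^esub> (u \<otimes>\<^bsub>env r\<^esub> env_const r c) \<otimes>\<^bsub>env r\<^esub> v"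
    using assms(2) closed by (simp add: env_bigraded_def r_distr m_assoc)
  \<comment> \<open>Centrality of scalars brings the eigenvalue of \<open>v\<close> to the front,
    where it joins that of \<open>u\<close>.\<close>
  also have "u \<otimes>\<^bsub>env r\<^esub> env_const r c = env_const r c \<otimes>\<^bsub>env r\<^esub> u"
    using env_const_commute[OF closed(1)] by simp
  finally show ?thesis
    using assms closed
    by (simp add: env_bigraded_def env_grade_mult env_const_add l_distr m_assoc a_ac)
qed

lemma env_bigraded_one: "env_bigraded r H 0 0 \<one>\<^bsub>env r\<^esub>"
  using env_bigraded_const[of 1] by (simp add: env_const_1)

lemma env_bigraded_divided_power:
  assumes "env_bigraded r H d c u"
  shows "env_bigraded r H (m * d) (of_nat m * c) (divided_power r u m)"
proof -
  interpret ring "env r" by (rule ring_env)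
  have "env_bigraded r H (m * d) (of_nat m * c) (u [^]\<^bsub>env r\<^esub> m)"
  proof (induction m)
    case (Suc m)
    from env_bigraded_mult[OF this assms] show ?case
      by (simp add: algebra_simps)
  qed (simp add: env_bigraded_one)
  \<comment> \<open>The factor \<open>1 / fact m\<close> has degree 0 and weight 0.\<close>
  from env_bigraded_mult[OF env_bigraded_const this] show ?thesis
    by (simp add: divided_power_def)
qed

lemma env_bigraded_ordered_prod:
  assumes "\<And>i. i \<in> set xs \<Longrightarrow> env_bigraded r H (d i) (c i) (f i)"
  shows "env_bigraded r H (\<Sum>i\<leftarrow>xs. d i) (\<Sum>i\<leftarrow>xs. c i) (ordered_prod (env r) (map f xs))"
  using assms
proof (induction xs)
  case (Cons x xs)
  then have "env_bigraded r H (d x) (c x) (f x)"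
    "env_bigraded r H (\<Sum>i\<leftarrow>xs. d i) (\<Sum>i\<leftarrow>xs. c i) (ordered_prod (env r) (map f xs))"
    by simp_all
  from env_bigraded_mult[OF this] show ?case
    by (simp add: ordered_prod_def)
qed (simp add: ordered_prod_def env_bigraded_one)

lemma env_bigraded_ordered_prod_upt:
  assumes "\<And>i. m \<le> i \<Longrightarrow> i < n \<Longrightarrow> env_bigraded r H (d i) (c i) (f i)"
  shows "env_bigraded r H (\<Sum>i = m..<n. d i) (\<Sum>i = m..<n. c i)
    (ordered_prod (env r) (map f [m..<n]))"
  using env_bigraded_ordered_prod[of "[m..<n]" d c f] assms
  by (simp add: sum_list_distinct_conv_sum_set)

text \<open>The single non-zero entry sits at the 0-based position \<open>(j, i - 1)\<close>, on
  which a diagonal matrix acts by the difference of its diagonal entries \<open>j\<close> and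
  \<open>i - 1\<close>; the power of t is only a common factor.\<close>

lemma env_bigraded_x_minus:
  assumes "1 \<le> i" "i \<le> j" "j \<le> r"
  shows "env_bigraded r H k (eps (j + 1) H - eps i H) (env_of r (tens (x_minus r i j) (monom 1 k)))"
proof -
  let ?x = "tens (x_minus r i j) (monom 1 k)"
  have x: "?x \<in> current_algebra r"
    by (rule tens_in_current_algebra[OF x_minus_in_sl[OF assms]])
  have h: "tens H 1 \<in> current_algebra r" "tens H 1 \<in> carrier_mat (r + 1) (r + 1)"
    "diagonal_mat (tens H 1)" "H \<in> carrier_mat (r + 1) (r + 1)"
    using H tens_in_current_algebra[of H r 1]
    by (auto simp: cartan_def sl_def tens_def diagonal_mat_def)
  \<comment> \<open>The eigenvalue is written as a constant polynomial, the form in which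
    \<open>env_of_smult\<close> extracts scalars.\<close>
  have "lie_bracket (tens H 1) ?x = [:eps (j + 1) H - eps i H:] \<cdot>\<^sub>m ?x"
  proof (rule eq_matI)
    fix p q
    assume "p < dim_row ([:eps (j + 1) H - eps i H:] \<cdot>\<^sub>m ?x)"
      "q < dim_col ([:eps (j + 1) H - eps i H:] \<cdot>\<^sub>m ?x)"
    then have pq: "p < r + 1" "q < r + 1"
      by (auto simp: tens_def x_minus_def)
    have "?x \<in> carrier_mat (r + 1) (r + 1)"
      using x by (simp add: current_algebra_def sl_def)
    from lie_bracket_diagonal[OF h(2,3) this pq]
    show "lie_bracket (tens H 1) ?x $$ (p, q) = ([:eps (j + 1) H - eps i H:] \<cdot>\<^sub>m ?x) $$ (p, q)"
      using h(4) pq by (auto simp: tens_def x_minus_def eps_def smult_diff_left)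
  qed (use h in \<open>auto simp: lie_bracket_def tens_def x_minus_def\<close>)
  with env_of_commutator[OF h(1) x] env_of_smult[OF x] show ?thesis
    by (simp add: env_bigraded_def env_of_in_env_grade[OF x_minus_in_sl[OF assms]])
qed

end


section \<open>The monomial of a partition overlaid pattern\<close>

text \<open>Both sums sort the non-zero terms of the partition by their value, which lies in
  \<open>{1..b}\<close>; the zero parts then fill the count up to \<open>a\<close>.\<close>

lemma
  assumes "is_partition \<pi>" "fits \<pi> (int a) (int b)"
  shows sum_part_mult: "(\<Sum>k = 0..<b + 1. part_mult a b \<pi> k) = a"
    and weighted_sum_part_mult: "(\<Sum>k = 0..<b + 1. part_mult a b \<pi> k * k) = partition_size \<pi>"
proof -
  define S where "S = {n. \<pi> n \<noteq> 0}"
  obtain N where "\<forall>n\<ge>N. \<pi> n = 0"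
    using assms(1) by (auto simp: is_partition_def)
  then have "S \<subseteq> {..<N}"
    unfolding S_def by (metis (mono_tags, lifting) lessThan_iff mem_Collect_eq not_le subsetI)
  \<comment> \<open>Finiteness makes \<open>card\<close> an honest count; on infinite sets it would
    be 0 by default.\<close>
  then have fin: "finite S"
    by (rule finite_subset) simp
  have im: "\<pi> ` S \<subseteq> {1..b}"
    using assms(2) by (auto simp: fits_def S_def)
  have fib: "{n \<in> S. \<pi> n = k} = {n. \<pi> n = k}" if "1 \<le> k" for k
    using that by (auto simp: S_def)
  have "(\<Sum>k = 1..b. card {n. \<pi> n = k}) = (\<Sum>k = 1..b. \<Sum>n\<in>{n \<in> S. \<pi> n = k}. 1)"
    by (intro sum.cong refl) (simp add: fib)
  also have "\<dots> = card S"
    using sum.group[OF fin _ im, of "\<lambda>_. 1::nat"] by simp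
  finally have card: "(\<Sum>k = 1..b. card {n. \<pi> n = k}) = card S" .
  have "(\<Sum>k = 1..b. card {n. \<pi> n = k} * k) = (\<Sum>k = 1..b. \<Sum>n\<in>{n \<in> S. \<pi> n = k}. \<pi> n)"
    by (intro sum.cong refl) (simp add: fib)
  also have "\<dots> = partition_size \<pi>"
    using sum.group[OF fin _ im, of \<pi>] by (simp add: partition_size_def S_def)
  finally have size: "(\<Sum>k = 1..b. card {n. \<pi> n = k} * k) = partition_size \<pi>" .
  \<comment> \<open>The index 0 is separated because \<open>part_mult\<close> is defined differently
    there; in the weighted sum it contributes nothing.\<close>
  have split: "(\<Sum>k = 0..<b + 1. f k) = f 0 + (\<Sum>k = 1..b. f k)" for f :: "nat \<Rightarrow> nat"
    by (simp add: atLeastLessThanSuc_atLeastAtMost sum.atLeast_Suc_atMost)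
  \<comment> \<open>This bound keeps the natural-number subtraction in \<open>part_mult\<close> at 0
    from being truncated.\<close>
  have le: "card S \<le> a"
    using assms(2) by (simp add: fits_def S_def)
  have "(\<Sum>k = 1..b. part_mult a b \<pi> k) = card S"
    unfolding card[symmetric] by (intro sum.cong) (auto simp: part_mult_def)
  then show "(\<Sum>k = 0..<b + 1. part_mult a b \<pi> k) = a"
    unfolding split using card le by (simp add: part_mult_def)
  have "(\<Sum>k = 1..b. part_mult a b \<pi> k * k) = partition_size \<pi>"
    unfolding size[symmetric] by (intro sum.cong) (auto simp: part_mult_def)
  then show "(\<Sum>k = 0..<b + 1. part_mult a b \<pi> k * k) = partition_size \<pi>"
    unfolding split by simp
qed

lemma env_bigraded_x_elem:
  assumes "H \<in> cartan r" "1 \<le> i" "i \<le> j" "j \<le> r"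
    and "is_partition \<pi>" "fits \<pi> (int a) (int b)"
  shows "env_bigraded r H (partition_size \<pi>) (of_nat a * (eps (j + 1) H - eps i H))
    (x_elem r i j a b \<pi>)"
proof -
  have "env_bigraded r H (\<Sum>k = 0..<b + 1. part_mult a b \<pi> k * k)
      (\<Sum>k = 0..<b + 1. of_nat (part_mult a b \<pi> k) * (eps (j + 1) H - eps i H)) (x_elem r i j a b \<pi>)"
    unfolding x_elem_def
    by (intro env_bigraded_ordered_prod_upt env_bigraded_divided_power env_bigraded_x_minus assms)
  then show ?thesis
    unfolding sum_distrib_right[symmetric] of_nat_sum[symmetric] sum_part_mult[OF assms(5,6)]
      weighted_sum_part_mult[OF assms(5,6)] .
qed

lemma env_bigraded_rho:
  assumes "H \<in> cartan r" "is_POP (r + 1) P"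
  shows "env_bigraded r H (num_boxes (r + 1) P)
    (\<Sum>j = 1..<r + 1. \<Sum>i = 1..<j + 1.
       of_int (pattern P (j + 1) i - pattern P j i) * (eps (j + 1) H - eps i H)) (rho r P)"
proof -
  have "env_bigraded r H (\<Sum>j = 1..<r + 1. \<Sum>i = 1..<j + 1. partition_size (overlay P j i))
    (\<Sum>j = 1..<r + 1. \<Sum>i = 1..<j + 1.
       of_int (pattern P (j + 1) i - pattern P j i) * (eps (j + 1) H - eps i H)) (rho r P)"
    unfolding rho_def rho_row_def
  proof (intro env_bigraded_ordered_prod_upt assms(1))
    fix i j
    assume ij: "1 \<le> j" "j < r + 1" "1 \<le> i" "i < j + 1"
    let ?a = "pattern P (j + 1) i - pattern P j i"
    let ?b = "pattern P j i - pattern P (j + 1) (i + 1)"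
    \<comment> \<open>Interlacing gives both signs, so the passage through \<open>nat\<close> in
      \<open>rho_row\<close> loses nothing.\<close>
    have "?a \<ge> 0" "?b \<ge> 0" "is_partition (overlay P j i)" "fits (overlay P j i) ?a ?b"
      using assms(2) ij by (auto simp: is_POP_def is_GT_pattern_def)
    then show "env_bigraded r H (partition_size (overlay P j i))
        (of_int ?a * (eps (j + 1) H - eps i H)) (x_elem r i j (nat ?a) (nat ?b) (overlay P j i))"
      using env_bigraded_x_elem[OF assms(1), of i j "overlay P j i" "nat ?a" "nat ?b"] ij
      by (simp add: of_nat_nat)
  qed
  then show ?thesis
    by (simp add: num_boxes_def atLeastLessThanSuc_atLeastAtMost)
qed

text \<open>Induction from the bottom row upwards: a new top row brings one new summand, which
  trades it for the row below plus one finished coordinate of the weight.\<close>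

lemma GT_weight_telescope:
  fixes e :: "nat \<Rightarrow> 'a::comm_ring_1"
  shows "(\<Sum>i = 1..n + 1. of_int (p (n + 1) i) * e i)
      + (\<Sum>j = 1..<n + 1. \<Sum>i = 1..<j + 1. of_int (p (j + 1) i - p j i) * (e (j + 1) - e i))
    = (\<Sum>i = 1..n + 1. of_int (GT_weight p i) * e i)"
proof (induction n)
  case (Suc n)
  let ?p = "\<lambda>i. of_int (p (n + 1) i) :: 'a" and ?q = "\<lambda>i. of_int (p (Suc n + 1) i) :: 'a"
  let ?f = "\<lambda>j. \<Sum>i = 1..<j + 1. of_int (p (j + 1) i - p j i) * (e (j + 1) - e i)"
  \<comment> \<open>Expanding the new summand isolates three pieces: the difference of row sums at
    the new coordinate, the removal of the upper row, and the insertion of the lower one.\<close>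
  have last: "?f (n + 1)
      = ((\<Sum>i = 1..n + 1. ?q i) - (\<Sum>i = 1..n + 1. ?p i)) * e (Suc n + 1)
        - (\<Sum>i = 1..n + 1. ?q i * e i) + (\<Sum>i = 1..n + 1. ?p i * e i)"
    unfolding add_Suc Suc_eq_plus1[symmetric] atLeastLessThanSuc_atLeastAtMost
    by (simp only: of_int_diff sum_subtractf sum_distrib_right left_diff_distrib right_diff_distrib
        diff_diff_eq2 diff_add_eq sum.distrib)
  have weight: "of_int (GT_weight p (Suc n + 1))
      = (\<Sum>i = 1..n + 1. ?q i) + ?q (Suc n + 1) - (\<Sum>i = 1..n + 1. ?p i)"
    by (simp add: GT_weight_def)
  have split: "(\<Sum>i = 1..Suc n + 1. g i) = (\<Sum>i = 1..n + 1. g i) + g (Suc n + 1)"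
    "(\<Sum>j = 1..<Suc n + 1. g j) = (\<Sum>j = 1..<n + 1. g j) + g (n + 1)" for g :: "nat \<Rightarrow> 'a"
    by simp_all
  \<comment> \<open>Here \<open>Q\<close> and \<open>R\<close> stand for the upper and lower row as
    weights, \<open>A\<close> and \<open>B\<close> for their sums, all over the first
    \<open>n + 1\<close> entries; \<open>q\<close> is the last entry of the upper row,
    \<open>c\<close> its coordinate, and \<open>F\<close> the earlier summands. \<open>R + F\<close>
    is the left side of the induction hypothesis.\<close>
  have ring: "Q + q * c + (F + ((A - B) * c - Q + R)) = (R + F) + (A + q - B) * c"
    for A B F Q R c q :: 'a
    by (simp add: algebra_simps)
  show ?case
    unfolding split last weight ring Suc.IH ..
qed (simp add: GT_weight_def)


section \<open>Quotients by left ideals\<close>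

lemma gen_left_ideal_is_left_ideal:
  assumes "ring R" "S \<subseteq> carrier R"
  shows "left_ideal (gen_left_ideal R S) R"
proof -
  interpret ring R by fact
  \<comment> \<open>The whole ring belongs to the family being intersected, which is therefore
    non-empty.\<close>
  have carr: "left_ideal (carrier R) R"
    using ideal.axioms(1)[OF oneideal] by (simp add: left_ideal_def)
  have sub: "subgroup J (add_monoid R)" if "left_ideal J R" for J
    using that by (simp add: left_ideal_def additive_subgroup_def)
  have "subgroup (gen_left_ideal R S) (add_monoid R)"
    unfolding gen_left_ideal_def
    by (rule add.subgroups_Inter) (use carr assms(2) sub in auto)
  moreover have "\<forall>a\<in>carrier R. \<forall>x\<in>gen_left_ideal R S. a \<otimes>\<^bsub>R\<^esub> x \<in> gen_left_ideal R S"
    unfolding gen_left_ideal_def left_ideal_def by blast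
  ultimately show ?thesis
    by (simp add: left_ideal_def additive_subgroup_def)
qed

lemma gen_left_ideal_superset: "S \<subseteq> gen_left_ideal R S"
  by (auto simp: gen_left_ideal_def)

text \<open>Representatives of a coset differ by an element of \<open>J\<close>, which left
  multiplication by \<open>a\<close> keeps in \<open>J\<close>; hence the union defining the action
  runs over equal cosets.\<close>

lemma quot_module_smult:
  fixes R :: "'a ring" (structure)
  assumes "ring R" "left_ideal J R" "a \<in> carrier R" "x \<in> carrier R"
  shows "a \<odot>\<^bsub>quot_module R J\<^esub> (J +> x) = J +> (a \<otimes> x)"
proof -
  interpret ring R by fact
  interpret J: abelian_subgroup J R
    using assms(2) by (intro abelian_subgroupI3 is_abelian_group) (simp add: left_ideal_def)
  have "J +> (a \<otimes> b) = J +> (a \<otimes> x)" if "b \<in> J +> x" for b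
  proof -
    obtain y where y: "y \<in> J" "b = y \<oplus> x"
      using \<open>b \<in> J +> x\<close> by (auto simp: a_r_coset_def')
    have "a \<otimes> b = a \<otimes> y \<oplus> a \<otimes> x"
      using y assms J.a_subset by (simp add: r_distr subsetD)
    moreover have "a \<otimes> y \<in> J"
      using assms(2,3) y by (simp add: left_ideal_def)
    ultimately have "a \<otimes> b \<in> J +> (a \<otimes> x)"
      by (auto simp: a_r_coset_def')
    from J.a_repr_independence'[OF this] show ?thesis
      using assms by simp
  qed
  \<comment> \<open>A union of equal sets collapses because the index set contains
    \<open>x\<close>.\<close>
  then have "(\<Union>b\<in>J +> x. J +> (a \<otimes> b)) = J +> (a \<otimes> x)"
    by (intro UN_constant_eq[OF J.a_rcos_self[OF assms(4)]] ballI)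
  then show ?thesis
    by (simp add: quot_module_def)
qed

section \<open>The local Weyl module and its weight spaces\<close>

lemma weyl_relations_subset: "weyl_relations r \<Lambda> \<subseteq> carrier (env r)"
proof -
  interpret ring "env r" by (rule ring_env)
  show ?thesis
    by (auto simp: weyl_relations_def cartan_def n_plus_def root_space_def
        simp del: nat_pow_Suc
        intro!: env_of_closed tens_in_current_algebra minus_closed nat_pow_closed)
qed

lemma left_ideal_weyl_ideal: "left_ideal (weyl_ideal r \<Lambda>) (env r)"
  unfolding weyl_ideal_def
  by (rule gen_left_ideal_is_left_ideal[OF ring_env weyl_relations_subset])

text \<open>The generator is the coset of 1, so statements about vectors of the module become
  congruences modulo \<open>weyl_ideal\<close>.\<close>

lemma smult_weyl_gen:
  assumes "u \<in> carrier (env r)"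
  shows "u \<odot>\<^bsub>local_weyl r \<Lambda>\<^esub> weyl_gen r \<Lambda> = weyl_ideal r \<Lambda> +>\<^bsub>env r\<^esub> u"
proof -
  interpret ring "env r" by (rule ring_env)
  show ?thesis
    using quot_module_smult[OF ring_env left_ideal_weyl_ideal assms, of "\<one>\<^bsub>env r\<^esub>" \<Lambda>] assms
    by (simp add: local_weyl_def weyl_gen_def)
qed

text \<open>Commuting \<open>H\<close> past \<open>u\<close> costs \<open>c H\<close>, after which
  \<open>H\<close> meets the generator and acts there by \<open>\<Lambda> H\<close>.\<close>

lemma weyl_weight_space_if_bigraded:
  assumes u: "u \<in> carrier (env r)"
    and "\<And>H. H \<in> cartan r \<Longrightarrow> env_bigraded r H d (c H) u"
    and "\<And>H. H \<in> cartan r \<Longrightarrow> \<mu> H = \<Lambda> H + c H"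
  shows "u \<odot>\<^bsub>local_weyl r \<Lambda>\<^esub> weyl_gen r \<Lambda> \<in> weyl_weight_space r \<Lambda> \<mu>"
proof -
  interpret ring "env r" by (rule ring_env)
  let ?J = "weyl_ideal r \<Lambda>"
  interpret J: abelian_subgroup ?J "env r"
    using left_ideal_weyl_ideal by (intro abelian_subgroupI3 is_abelian_group) (simp add: left_ideal_def)
  have carr: "?J +>\<^bsub>env r\<^esub> u \<in> carrier (local_weyl r \<Lambda>)"
    using u by (auto simp: local_weyl_def quot_module_def A_RCOSETS_def')
  have "env_of r (tens H 1) \<odot>\<^bsub>local_weyl r \<Lambda>\<^esub> (?J +>\<^bsub>env r\<^esub> u)
      = env_const r (\<mu> H) \<odot>\<^bsub>local_weyl r \<Lambda>\<^esub> (?J +>\<^bsub>env r\<^esub> u)" if H: "H \<in> cartan r" for H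
  proof -
    let ?h = "env_of r (tens H 1)"
    note h = env_of_cartan_closed[OF H]
    have "?h \<ominus>\<^bsub>env r\<^esub> env_const r (\<Lambda> H) \<in> ?J"
      using gen_left_ideal_superset[of "weyl_relations r \<Lambda>" "env r"] H
      by (auto simp: weyl_ideal_def weyl_relations_def)
    \<comment> \<open>The relation stands on the right of \<open>u\<close>, so absorption from the
      left puts the product into the ideal.\<close>
    then have *: "u \<otimes>\<^bsub>env r\<^esub> (?h \<ominus>\<^bsub>env r\<^esub> env_const r (\<Lambda> H)) \<in> ?J"
      using left_ideal_weyl_ideal[of r \<Lambda>] u by (simp add: left_ideal_def)
    have "?h \<otimes>\<^bsub>env r\<^esub> u
        = u \<otimes>\<^bsub>env r\<^esub> ?h \<oplus>\<^bsub>env r\<^esub> env_const r (c H) \<otimes>\<^bsub>env r\<^esub> u"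
      using assms(2)[OF H] by (simp add: env_bigraded_def)
    also have "u \<otimes>\<^bsub>env r\<^esub> ?h = u \<otimes>\<^bsub>env r\<^esub> (?h \<ominus>\<^bsub>env r\<^esub> env_const r (\<Lambda> H))
        \<oplus>\<^bsub>env r\<^esub> env_const r (\<Lambda> H) \<otimes>\<^bsub>env r\<^esub> u"
      using u h by (simp add: env_const_commute a_minus_def r_distr r_minus a_assoc l_neg)
    also have "\<dots> \<oplus>\<^bsub>env r\<^esub> env_const r (c H) \<otimes>\<^bsub>env r\<^esub> u
        = u \<otimes>\<^bsub>env r\<^esub> (?h \<ominus>\<^bsub>env r\<^esub> env_const r (\<Lambda> H))
          \<oplus>\<^bsub>env r\<^esub> env_const r (\<mu> H) \<otimes>\<^bsub>env r\<^esub> u"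
      using u h by (simp add: assms(3)[OF H] env_const_add l_distr a_assoc)
    finally have "?h \<otimes>\<^bsub>env r\<^esub> u \<in> ?J +>\<^bsub>env r\<^esub> (env_const r (\<mu> H) \<otimes>\<^bsub>env r\<^esub> u)"
      using * by (auto simp: a_r_coset_def')
    then have "?J +>\<^bsub>env r\<^esub> (env_const r (\<mu> H) \<otimes>\<^bsub>env r\<^esub> u) = ?J +>\<^bsub>env r\<^esub> (?h \<otimes>\<^bsub>env r\<^esub> u)"
      by (rule J.a_repr_independence') (simp add: u)
    then show ?thesis
      using quot_module_smult[OF ring_env left_ideal_weyl_ideal _ u] h by (simp add: local_weyl_def)
  qed
  with carr show ?thesis
    by (simp add: weyl_weight_space_def smult_weyl_gen[OF u])
qed

theorem proposition4p4:
  fixes r :: nat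
    and \<Lambda> :: "complex mat \<Rightarrow> complex"
    and lam :: "nat \<Rightarrow> int"
    and P :: pop
  assumes "r \<ge> 1"
    and "dominant_integral r \<Lambda>"
    and "corresponding_tuple r \<Lambda> lam"
    and "is_POP (r + 1) P"
    and "has_bounding_sequence (r + 1) P lam"
  shows "v_vec r \<Lambda> P \<in> weyl_grade r \<Lambda> (num_boxes (r + 1) P) \<and>
         v_vec r \<Lambda> P \<in> weyl_weight_space r \<Lambda> (tuple_weight r (GT_weight (pattern P)))"
proof
  \<comment> \<open>The grade does not depend on \<open>H\<close>, but \<open>env_bigraded\<close>
    requires some Cartan element; zero serves as witness.\<close>
  have "0\<^sub>m (r + 1) (r + 1) \<in> cartan r"
    by (auto simp: cartan_def sl_def mat_trace_def diagonal_mat_def)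
  then have rho: "rho r P \<in> env_grade r (num_boxes (r + 1) P)"
    using env_bigraded_rho[OF _ assms(4)] by (auto simp: env_bigraded_def)
  then show "v_vec r \<Lambda> P \<in> weyl_grade r \<Lambda> (num_boxes (r + 1) P)"
    by (auto simp: v_vec_def weyl_grade_def)
  show "v_vec r \<Lambda> P \<in> weyl_weight_space r \<Lambda> (tuple_weight r (GT_weight (pattern P)))"
    unfolding v_vec_def
  proof (rule weyl_weight_space_if_bigraded)
    show "rho r P \<in> carrier (env r)"
      using rho env_grade_subset by blast
  next
    fix H
    assume H: "H \<in> cartan r"
    \<comment> \<open>The bounding sequence identifies the highest weight with the top row, the
      starting point of the telescoping sum.\<close>
    have "\<Lambda> H = (\<Sum>i = 1..r + 1. of_int (pattern P (r + 1) i) * eps i H)"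
      using assms(3,5) H by (simp add: corresponding_tuple_def has_bounding_sequence_def tuple_weight_def)
    then show "tuple_weight r (GT_weight (pattern P)) H = \<Lambda> H +
        (\<Sum>j = 1..<r + 1. \<Sum>i = 1..<j + 1.
           of_int (pattern P (j + 1) i - pattern P j i) * (eps (j + 1) H - eps i H))"
      using GT_weight_telescope[of "pattern P" r "\<lambda>i. eps i H"] by (simp only: tuple_weight_def)
  qed (rule env_bigraded_rho[OF _ assms(4)])
qed

end
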